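(* Let $u_0\in L^\infty(\Omega)$ satisfy $0\le u_0(x)\le 1$ for a.e. $x\in\Omega$ and $u_0(1-u_0)\not\equiv 0$, and let $u$ be the corresponding global solution of Problem $(P)$. Suppose that $$|\{x\in\Omega: u_0(x)=s\}|=0\quad\text{for all } s\in(0,1).$$ Then $$l_g:=\lim_{t\to\infty}\int_\Omega g(u(x,t))\,dx=0\quad\text{and}\quad l_f:=\lim_{t\to\infty}\int_\Omega f(u(x,t))\,dx=0.$$
   Context: $\Omega$ is an open bounded subset of $\mathbb{R}^N$, $N\ge 1$; $|A|$ is the Lebesgue measure of $A$. Set $f(z):=z^2(1-z)$ and $g(z):=z(1-z)$ for $z\in\mathbb{R}$. Problem $(P)$ is the nonlocal differential equation $u_t=u^2(1-u)-\lambda(t)\,u(1-u)$ for $x\in\Omega$, $t\ge 0$, with $u(x,0)=u_0(x)$, where $$\lambda(t):=\frac{\int_\Omega u^2(1-u)(x,t)\,dx}{\int_\Omega u(1-u)(x,t)\,dx}.$$ A (global) solution is a function $u\in C^1([0,\infty);L^\infty(\Omega))$ with $u(0)=u_0$, $\int_\Omega g(u(x,t))\,dx\ne 0$ for all $t\ge 0$, and $u_t(x,t)=f(u(x,t))-\lambda(t)g(u(x,t))$ for a.e. $x\in\Omega$ and all $t\ge0$. Known fact: if $u_0\in L^\infty(\Omega)$, $0\le u_0\le1$ a.e. and $u_0(1-u_0)\not\equiv0$ (not a.e. equal to $0$), then $(P)$ has a global solution $u$, and $0\le u(x,t)\le 1$ for a.e. $x\in\Omega$ and all $t\ge0$; $u$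 and $\lambda$ refer to this solution. *)

theory Defs
  imports "HOL-Analysis.Analysis" "HOL-Probability.Essential_Supremum"
begin

text \<open>Elements of \<open>L\<^sup>\<infinity>(\<Omega>)\<close> are represented by functions on the whole space, only their values on
  \<open>\<Omega>\<close> (up to null sets) being relevant. Since \<open>esssup\<close> is \<open>top\<close> on non-measurable functions, and
  \<open>\<bar>v\<bar>\<close> may be measurable when \<open>v\<close> is not, measurability of \<open>v\<close> is required separately.\<close>

definition Linf_norm :: "'a::euclidean_space set \<Rightarrow> ('a \<Rightarrow> real) \<Rightarrow> ennreal" where
  "Linf_norm \<Omega> v = esssup (lebesgue_on \<Omega>) (\<lambda>x. ennreal \<bar>v x\<bar>)"

definition Linf :: "'a::euclidean_space set \<Rightarrow> ('a \<Rightarrow> real) set" where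
  "Linf \<Omega> = {v \<in> borel_measurable (lebesgue_on \<Omega>). Linf_norm \<Omega> v < \<infinity>}"

text \<open>\<open>u\<close> belongs to \<open>C\<^sup>1([0,\<infinity>); L\<^sup>\<infinity>(\<Omega>))\<close> with derivative \<open>u'\<close> (one-sided at time \<open>0\<close>); the time
  variable is the first argument.\<close>

definition C1_Linf ::
    "'a::euclidean_space set \<Rightarrow> (real \<Rightarrow> 'a \<Rightarrow> real) \<Rightarrow> (real \<Rightarrow> 'a \<Rightarrow> real) \<Rightarrow> bool" where
  "C1_Linf \<Omega> u u' \<longleftrightarrow>
     (\<forall>t\<ge>0. u t \<in> Linf \<Omega> \<and> u' t \<in> Linf \<Omega>) \<and>
     (\<forall>t\<ge>0. ((\<lambda>s. Linf_norm \<Omega> (\<lambda>x. (u s x - u t x) / (s - t) - u' t x)) \<longlongrightarrow> 0)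
              (at t within {0..})) \<and>
     (\<forall>t\<ge>0. ((\<lambda>s. Linf_norm \<Omega> (\<lambda>x. u' s x - u' t x)) \<longlongrightarrow> 0) (at t within {0..}))"

definition f_react :: "real \<Rightarrow> real" where
  "f_react z = z\<^sup>2 * (1 - z)"

definition g_react :: "real \<Rightarrow> real" where
  "g_react z = z * (1 - z)"

definition lam :: "'a::euclidean_space set \<Rightarrow> (real \<Rightarrow> 'a \<Rightarrow> real) \<Rightarrow> real \<Rightarrow> real" where
  "lam \<Omega> u t = (LINT x|lebesgue_on \<Omega>. f_react (u t x)) / (LINT x|lebesgue_on \<Omega>. g_react (u t x))"

text \<open>The equation is read as an identity in \<open>L\<^sup>\<infinity>(\<Omega>)\<close> for every \<open>t \<ge> 0\<close>, so the exceptional null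
  set may depend on \<open>t\<close>.\<close>

definition global_solution ::
    "'a::euclidean_space set \<Rightarrow> ('a \<Rightarrow> real) \<Rightarrow> (real \<Rightarrow> 'a \<Rightarrow> real) \<Rightarrow> bool" where
  "global_solution \<Omega> u0 u \<longleftrightarrow>
     (\<exists>u'. C1_Linf \<Omega> u u' \<and>
        (AE x in lebesgue_on \<Omega>. u 0 x = u0 x) \<and>
        (\<forall>t\<ge>0. (LINT x|lebesgue_on \<Omega>. g_react (u t x)) \<noteq> 0) \<and>
        (\<forall>t\<ge>0. AE x in lebesgue_on \<Omega>.
            u' t x = f_react (u t x) - lam \<Omega> u t * g_react (u t x)))"

end

theory Submission
  imports Defs
begin

text \<open>After modification on null sets, \<open>u\<close> solves \<open>y' = y (1 - y) (y - \<lambda>(t))\<close> pointwise: for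
  almost every \<open>x\<close> and all \<open>t\<close>. Along two trajectories \<open>p < q\<close> in \<open>(0, 1)\<close> the difference \<open>D\<close> of the logits
  satisfies \<open>D' = q - p > 0\<close>, whatever \<open>\<lambda>\<close> is, so the trajectories cannot both stay away from
  \<open>{0, 1}\<close>: \<open>g(p) g(q) \<rightarrow> 0\<close> by a Barbalat argument. As the level sets of \<open>u0\<close> in \<open>(0, 1)\<close> are null,
  this applies to almost every pair of points with initial values in \<open>(0, 1)\<close>, and dominated
  convergence gives \<open>(\<integral> g(u))\<^sup>2 = \<integral> \<integral> g(u(x)) g(u(y)) \<rightarrow> 0\<close>. Finally \<open>0 \<le> f(u) \<le> g(u)\<close>.\<close>

section \<open>Curves in \<open>L\<^sup>\<infinity>\<close> and their pointwise representatives\<close>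

text \<open>Continuity in the L-infinity norm, spelled out with almost everywhere inequalities. The
  exceptional null set may depend on both \<open>s\<close> and \<open>t\<close>, so nothing is
  claimed yet about the trajectory of a single \<open>x\<close>.\<close>

definition Linf_continuous :: "'a measure \<Rightarrow> (real \<Rightarrow> 'a \<Rightarrow> real) \<Rightarrow> bool" where
  "Linf_continuous M v \<longleftrightarrow> (\<forall>t\<ge>0. \<forall>e>0. \<exists>d>0. \<forall>s\<ge>0. \<bar>s - t\<bar> < d \<longrightarrow>
     (AE x in M. \<bar>v s x - v t x\<bar> \<le> e))"

text \<open>The difference quotient is multiplied out, so that no division occurs and
  \<open>s = t\<close> is harmless. Restricting to \<open>s \<ge> 0\<close> makes the derivative
  one-sided at time \<open>0\<close>.\<close>

definition Linf_derivative ::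
    "'a measure \<Rightarrow> (real \<Rightarrow> 'a \<Rightarrow> real) \<Rightarrow> (real \<Rightarrow> 'a \<Rightarrow> real) \<Rightarrow> bool" where
  "Linf_derivative M v v' \<longleftrightarrow> (\<forall>t\<ge>0. \<forall>e>0. \<exists>d>0. \<forall>s\<ge>0. \<bar>s - t\<bar> < d \<longrightarrow>
     (AE x in M. \<bar>v s x - v t x - (s - t) * v' t x\<bar> \<le> e * \<bar>s - t\<bar>))"

text \<open>Heine-Cantor with almost everywhere inequalities: two times closer than a Lebesgue
  number of the cover lie in one ball, and \<open>v\<close> at either of them is within
  \<open>e / 2\<close> of \<open>v\<close> at the centre.\<close>

lemma Linf_continuous_uniform:
  assumes v: "Linf_continuous M v" and "e > 0"
  shows "\<exists>d>0. \<forall>s\<in>{0..T}. \<forall>t\<in>{0..T}. \<bar>s - t\<bar> < d \<longrightarrow> (AE x in M. \<bar>v s x - v t x\<bar> \<le> e)"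
proof (cases "T \<ge> 0")
  case False
  then show ?thesis by (intro exI[of _ 1]) auto
next
  case True
  have "\<forall>t\<in>{0..T}. \<exists>d>0. \<forall>s\<ge>0. \<bar>s - t\<bar> < d \<longrightarrow> (AE x in M. \<bar>v s x - v t x\<bar> \<le> e / 2)"
    using v[unfolded Linf_continuous_def, rule_format, OF _ half_gt_zero[OF \<open>e > 0\<close>]] by simp
  then obtain r where r: "\<And>t. t \<in> {0..T} \<Longrightarrow> r t > 0"
    "\<And>s t. t \<in> {0..T} \<Longrightarrow> s \<ge> 0 \<Longrightarrow> \<bar>s - t\<bar> < r t \<Longrightarrow> AE x in M. \<bar>v s x - v t x\<bar> \<le> e / 2"
    by metis
  obtain d where d: "d > 0"
    "\<And>S. S \<subseteq> {0..T} \<Longrightarrow> diameter S < d \<Longrightarrow> \<exists>B\<in>(\<lambda>t. ball t (r t)) ` {0..T}. S \<subseteq> B"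
  proof (rule Lebesgue_number_lemma[of "{0..T}" "(\<lambda>t. ball t (r t)) ` {0..T}"])
    show "{0..T} \<subseteq> \<Union> ((\<lambda>t. ball t (r t)) ` {0..T})"
      using r(1) by fastforce
  qed (use True in auto)
  show ?thesis
  proof (intro exI[of _ d] conjI ballI impI)
    fix s t assume st: "s \<in> {0..T}" "t \<in> {0..T}" "\<bar>s - t\<bar> < d"
    have "diameter {s, t} \<le> \<bar>s - t\<bar>"
      by (rule diameter_le) auto
    then obtain c where c: "c \<in> {0..T}" "{s, t} \<subseteq> ball c (r c)"
      using d(2)[of "{s, t}"] st by auto
    have "AE x in M. \<bar>v s x - v c x\<bar> \<le> e / 2" "AE x in M. \<bar>v t x - v c x\<bar> \<le> e / 2"
      using r(2)[of c s] r(2)[of c t] c st by (auto simp: dist_real_def abs_minus_commute)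
    then show "AE x in M. \<bar>v s x - v t x\<bar> \<le> e"
      by eventually_elim linarith
  qed (use d in simp)
qed

text \<open>The moduli are indexed by a horizon \<open>n\<close> and an accuracy
  \<open>1 / (m + 1)\<close>. Together with rational times this leaves countably many inequalities,
  whose null sets can be discarded all at once.\<close>

lemma Linf_continuous_modulus:
  assumes v: "Linf_continuous M v"
  shows "\<exists>d. \<forall>n m. d n m > (0::real) \<and> (\<forall>s\<in>{0..real n}. \<forall>t\<in>{0..real n}.
    \<bar>s - t\<bar> < d n m \<longrightarrow> (AE x in M. \<bar>v s x - v t x\<bar> \<le> inverse (Suc m)))"
  by (intro choice allI Linf_continuous_uniform[OF v]) simp

section \<open>Rational times and continuous representatives\<close>

definition rational_below :: "real \<Rightarrow> nat \<Rightarrow> real" where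
  "rational_below t k = of_int \<lfloor>t * real (Suc k)\<rfloor> / real (Suc k)"

text \<open>Rounding down costs at most \<open>1 / (k + 1)\<close>. Approximating from below keeps
  the approximants in every interval \<open>{0..n}\<close> that contains \<open>t\<close>, where the
  modulus for \<open>n\<close> applies.\<close>

lemma rational_below:
  assumes "t \<ge> 0"
  shows "rational_below t k \<in> \<rat>" "rational_below t k \<ge> 0" "rational_below t k \<le> t"
    "rational_below t \<longlonglongrightarrow> t"
proof -
  have le: "rational_below t k \<le> t" for k
    unfolding rational_below_def using of_int_floor_le[of "t * real (Suc k)"]
    by (simp add: divide_le_eq del: of_nat_Suc)
  then show "rational_below t k \<le> t" .
  show "rational_below t k \<in> \<rat>" "rational_below t k \<ge> 0"
    using assms by (auto simp: rational_below_def simp del: of_nat_Suc)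
  have ge: "t - inverse (Suc k) \<le> rational_below t k" for k
  proof -
    have "t * real (Suc k) - 1 \<le> of_int \<lfloor>t * real (Suc k)\<rfloor>"
      by linarith
    then have "(t * real (Suc k) - 1) / real (Suc k) \<le> rational_below t k"
      unfolding rational_below_def by (intro divide_right_mono) auto
    then show ?thesis
      by (simp add: diff_divide_distrib inverse_eq_divide del: of_nat_Suc)
  qed
  show "rational_below t \<longlonglongrightarrow> t"
  proof (rule tendsto_sandwich)
    show "(\<lambda>k. t - inverse (real (Suc k))) \<longlonglongrightarrow> t"
      using tendsto_diff[OF tendsto_const LIMSEQ_inverse_real_of_nat, of t] by simp
  qed (use le ge in auto)
qed

lemma AE_rational_pairs:
  fixes P :: "real \<Rightarrow> real \<Rightarrow> 'a \<Rightarrow> bool"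
  assumes "\<And>p q. p \<in> \<rat> \<Longrightarrow> p \<ge> 0 \<Longrightarrow> q \<in> \<rat> \<Longrightarrow> q \<ge> 0 \<Longrightarrow> AE x in M. P p q x"
  shows "AE x in M. \<forall>p\<in>\<rat>. \<forall>q\<in>\<rat>. p \<ge> 0 \<longrightarrow> q \<ge> 0 \<longrightarrow> P p q x"
proof (intro AE_ball_countable' countable_rat)
  fix p q :: real assume "p \<in> \<rat>" "q \<in> \<rat>"
  then show "AE x in M. p \<ge> 0 \<longrightarrow> q \<ge> 0 \<longrightarrow> P p q x"
    using assms[of p q] by (cases "p \<ge> 0 \<and> q \<ge> 0") auto
qed

text \<open>Outside one null set, \<open>v\<close> restricted to rational times is uniformly
  continuous on each bounded interval, with moduli that do not depend on \<open>x\<close>. Limits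
  along rational times then extend it continuously to all times.\<close>

lemma continuous_representative:
  fixes v :: "real \<Rightarrow> 'a \<Rightarrow> real"
  assumes v: "Linf_continuous M v" and meas [measurable]: "\<And>t. t \<ge> 0 \<Longrightarrow> v t \<in> borel_measurable M"
  obtains w where "\<And>t. w t \<in> borel_measurable M"
    "\<And>t. t \<ge> 0 \<Longrightarrow> AE x in M. w t x = v t x"
    "\<And>x. continuous_on {0..} (\<lambda>t. w t x)"
proof -
  obtain d where "\<forall>n m. d n m > (0::real) \<and> (\<forall>s\<in>{0..real n}. \<forall>t\<in>{0..real n}.
      \<bar>s - t\<bar> < d n m \<longrightarrow> (AE x in M. \<bar>v s x - v t x\<bar> \<le> inverse (Suc m)))"
    using Linf_continuous_modulus[OF v] by blast
  then have d: "d n m > 0"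
    "0 \<le> s \<Longrightarrow> s \<le> real n \<Longrightarrow> 0 \<le> t \<Longrightarrow> t \<le> real n \<Longrightarrow> \<bar>s - t\<bar> < d n m \<Longrightarrow>
      AE x in M. \<bar>v s x - v t x\<bar> \<le> inverse (Suc m)" for n m s t
    by auto
  define P where "P x \<longleftrightarrow> (\<forall>n m. \<forall>p\<in>\<rat>. \<forall>q\<in>\<rat>. p \<ge> 0 \<longrightarrow> q \<ge> 0 \<longrightarrow>
    p \<le> real n \<longrightarrow> q \<le> real n \<longrightarrow> \<bar>p - q\<bar> < d n m \<longrightarrow> \<bar>v p x - v q x\<bar> \<le> inverse (Suc m))" for x
  have "AE x in M. P x"
    unfolding P_def AE_all_countable
  proof (intro allI AE_rational_pairs)
    fix n m and p q :: real assume "p \<ge> 0" "q \<ge> 0"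
    then show "AE x in M. p \<le> real n \<longrightarrow> q \<le> real n \<longrightarrow> \<bar>p - q\<bar> < d n m \<longrightarrow>
        \<bar>v p x - v q x\<bar> \<le> inverse (Suc m)"
      using d(2)[of p n q m] by (cases "p \<le> real n \<and> q \<le> real n \<and> \<bar>p - q\<bar> < d n m") auto
  qed
  then obtain N where N: "{x \<in> space M. \<not> P x} \<subseteq> N" "emeasure M N = 0" "N \<in> sets M"
    by (rule AE_E)
  define r where "r = rational_below"
  \<comment> \<open>The default \<open>0\<close> on \<open>N\<close> and at negative times makes
    \<open>w t\<close> measurable for every \<open>t\<close> and the trajectory continuous for every
    \<open>x\<close>, without exceptions.\<close>
  define w where "w t x = (if t \<ge> 0 \<and> x \<in> space M - N then lim (\<lambda>k. v (r t k) x) else 0)" for t x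
  have good: "P x" if "x \<in> space M - N" for x
    using that N(1) by auto
  have r: "r t k \<in> \<rat>" "r t k \<ge> 0" "r t k \<le> t" "r t \<longlonglongrightarrow> t" if "t \<ge> 0" for t k
    unfolding r_def using rational_below[OF that] by auto
  have lim_w: "(\<lambda>k. v (r t k) x) \<longlonglongrightarrow> w t x" if "t \<ge> 0" "x \<in> space M - N" for t x
  proof -
    have "Cauchy (\<lambda>k. v (r t k) x)"
    proof (rule metric_CauchyI)
      fix e :: real assume "e > 0"
      then obtain m where m: "inverse (real (Suc m)) < e"
        using reals_Archimedean by blast
      obtain n where n: "t \<le> real n"
        using real_arch_simple by blast
      obtain K where K: "\<And>i j. i \<ge> K \<Longrightarrow> j \<ge> K \<Longrightarrow> dist (r t i) (r t j) < d n m"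
        using metric_CauchyD[OF LIMSEQ_imp_Cauchy[OF r(4)[OF \<open>t \<ge> 0\<close>]] d(1)[of n m]] by blast
      have "dist (v (r t i) x) (v (r t j) x) < e" if "i \<ge> K" "j \<ge> K" for i j
      proof -
        have "r t i \<le> real n" "r t j \<le> real n"
          using r(3)[OF \<open>t \<ge> 0\<close>] n by (meson order_trans)+
        then have "\<bar>v (r t i) x - v (r t j) x\<bar> \<le> inverse (Suc m)"
          using good[OF \<open>x \<in> space M - N\<close>] K[OF that] r(1,2)[OF \<open>t \<ge> 0\<close>]
          unfolding P_def dist_real_def by blast
        with m show ?thesis by (simp add: dist_real_def)
      qed
      then show "\<exists>K. \<forall>i\<ge>K. \<forall>j\<ge>K. dist (v (r t i) x) (v (r t j) x) < e"
        by blast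
    qed
    then show ?thesis
      using that by (simp add: w_def Cauchy_convergent_iff convergent_LIMSEQ_iff)
  qed
  \<comment> \<open>The modulus survives the passage to the limit: as
    \<open>\<bar>s - t\<bar> < d n m\<close> is strict, the rational approximants eventually satisfy
    it too.\<close>
  have w_diff: "\<bar>w s x - w t x\<bar> \<le> inverse (Suc m)"
    if st: "0 \<le> s" "s \<le> real n" "0 \<le> t" "t \<le> real n" "\<bar>s - t\<bar> < d n m" and x: "x \<in> space M - N"
    for s t n m x
  proof (rule tendsto_upperbound)
    show "(\<lambda>k. \<bar>v (r s k) x - v (r t k) x\<bar>) \<longlonglongrightarrow> \<bar>w s x - w t x\<bar>"
      using st x by (intro tendsto_intros lim_w)
    have "(\<lambda>k. \<bar>r s k - r t k\<bar>) \<longlonglongrightarrow> \<bar>s - t\<bar>"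
      using st by (intro tendsto_intros r(4))
    then have "\<forall>\<^sub>F k in sequentially. \<bar>r s k - r t k\<bar> < d n m"
      using st(5) by (rule order_tendstoD)
    then show "\<forall>\<^sub>F k in sequentially. \<bar>v (r s k) x - v (r t k) x\<bar> \<le> inverse (Suc m)"
    proof eventually_elim
      case (elim k)
      have "r s k \<le> real n" "r t k \<le> real n"
        using r(3)[OF st(1)] r(3)[OF st(3)] st by (meson order_trans)+
      then show ?case
        using good[OF x] elim r(1,2)[OF st(1)] r(1,2)[OF st(3)] unfolding P_def by blast
    qed
  qed simp
  show ?thesis
  proof
    fix t :: real
    show "w t \<in> borel_measurable M"
    proof (cases "t \<ge> 0")
      case True
      have [measurable]: "v (r t k) \<in> borel_measurable M" for k
        using r(2)[OF True] by (rule meas)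
      have [measurable]: "N \<in> sets M" by (rule N)
      show ?thesis
        unfolding w_def using True by simp
    qed (simp add: w_def[abs_def])
  next
    fix t :: real assume t: "t \<ge> 0"
    \<comment> \<open>The time \<open>t\<close> is fixed here, so a null set depending on
      \<open>t\<close> is allowed. The values \<open>v (r t k) x\<close> converge to
      \<open>w t x\<close> and are eventually close to \<open>v t x\<close>.\<close>
    have "AE x in M. \<forall>m. \<bar>w t x - v t x\<bar> \<le> inverse (Suc m)"
      unfolding AE_all_countable
    proof
      fix m :: nat
      obtain n where n: "t \<le> real n"
        using real_arch_simple by blast
      have "AE x in M. \<forall>k. \<bar>r t k - t\<bar> < d n m \<longrightarrow> \<bar>v (r t k) x - v t x\<bar> \<le> inverse (Suc m)"
        unfolding AE_all_countable
      proof
        fix k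
        have "r t k \<le> real n"
          using r(3)[OF t] n by (rule order_trans)
        then show "AE x in M. \<bar>r t k - t\<bar> < d n m \<longrightarrow> \<bar>v (r t k) x - v t x\<bar> \<le> inverse (Suc m)"
          using d(2)[OF r(2)[OF t] _ t n] by (cases "\<bar>r t k - t\<bar> < d n m") auto
      qed
      moreover have "AE x in M. x \<in> space M - N"
        using N AE_iff_null_sets[of N M] by (auto simp: null_sets_def)
      ultimately show "AE x in M. \<bar>w t x - v t x\<bar> \<le> inverse (Suc m)"
      proof eventually_elim
        case (elim x)
        show ?case
        proof (rule tendsto_upperbound)
          show "(\<lambda>k. \<bar>v (r t k) x - v t x\<bar>) \<longlonglongrightarrow> \<bar>w t x - v t x\<bar>"
            using elim t by (intro tendsto_intros lim_w)
          have "(\<lambda>k. \<bar>r t k - t\<bar>) \<longlonglongrightarrow> \<bar>t - t\<bar>"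
            using t by (intro tendsto_intros r(4))
          then have "\<forall>\<^sub>F k in sequentially. \<bar>r t k - t\<bar> < d n m"
            using d(1)[of n m] by (auto dest: order_tendstoD)
          then show "\<forall>\<^sub>F k in sequentially. \<bar>v (r t k) x - v t x\<bar> \<le> inverse (Suc m)"
            by eventually_elim (use elim in blast)
        qed simp
      qed
    qed
    then show "AE x in M. w t x = v t x"
    proof eventually_elim
      case (elim x)
      show ?case
      proof (rule ccontr)
        assume "w t x \<noteq> v t x"
        then obtain m where "inverse (real (Suc m)) < \<bar>w t x - v t x\<bar>"
          using reals_Archimedean[of "\<bar>w t x - v t x\<bar>"] by auto
        with elim show False by (meson not_less)
      qed
    qed
  next
    fix x
    show "continuous_on {0..} (\<lambda>t. w t x)"
    proof (cases "x \<in> space M - N")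
      case False
      then have "w t x = 0" for t
        by (auto simp: w_def)
      then show ?thesis by simp
    next
      case True
      show ?thesis
        unfolding continuous_on_iff
      proof (intro ballI allI impI)
        fix t e :: real assume t: "t \<in> {0..}" and "e > 0"
        then obtain m where m: "inverse (real (Suc m)) < e"
          using reals_Archimedean by blast
        \<comment> \<open>The extra \<open>1\<close> leaves room for all \<open>s\<close> with
          \<open>\<bar>s - t\<bar> < 1\<close> below the same horizon \<open>n\<close>.\<close>
        obtain n where n: "t + 1 \<le> real n"
          using real_arch_simple by blast
        have "dist (w s x) (w t x) < e" if "s \<ge> 0" "\<bar>s - t\<bar> < min 1 (d n m)" for s
        proof -
          have "s \<le> real n" "t \<le> real n"
            using that n by linarith+
          then show ?thesis
            using w_diff[of s n t m x] that t m True by (auto simp: dist_real_def)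
        qed
        then show "\<exists>\<delta>>0. \<forall>s\<in>{0..}. dist s t < \<delta> \<longrightarrow> dist (w s x) (w t x) < e"
          using d(1)[of n m] by (intro exI[of _ "min 1 (d n m)"]) (auto simp: dist_real_def)
      qed
    qed
  qed
qed

section \<open>Continuity of differentiable and of composed curves\<close>

lemma Linf_derivative_imp_continuous:
  assumes v: "Linf_derivative M v v'" and bdd: "\<And>t. t \<ge> 0 \<Longrightarrow> \<exists>C. AE x in M. \<bar>v' t x\<bar> \<le> C"
  shows "Linf_continuous M v"
  unfolding Linf_continuous_def
proof (intro allI impI)
  fix t e :: real assume "t \<ge> 0" "e > 0"
  obtain C where C: "AE x in M. \<bar>v' t x\<bar> \<le> C"
    using bdd \<open>t \<ge> 0\<close> by blast
  obtain d where d: "d > 0" "\<And>s. s \<ge> 0 \<Longrightarrow> \<bar>s - t\<bar> < d \<Longrightarrow>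
      AE x in M. \<bar>v s x - v t x - (s - t) * v' t x\<bar> \<le> 1 * \<bar>s - t\<bar>"
    using v[unfolded Linf_derivative_def, rule_format, OF \<open>t \<ge> 0\<close> zero_less_one] by blast
  \<comment> \<open>A local Lipschitz constant at \<open>t\<close>: the remainder, taken with
    tolerance \<open>1\<close>, contributes \<open>1\<close> and the derivative at most
    \<open>\<bar>C\<bar>\<close>.\<close>
  define K where "K = 1 + \<bar>C\<bar>"
  have "K > 0" by (simp add: K_def)
  have "AE x in M. \<bar>v s x - v t x\<bar> \<le> e" if "s \<ge> 0" "\<bar>s - t\<bar> < min d (e / K)" for s
  proof -
    have le: "\<bar>s - t\<bar> * K \<le> e"
      using that \<open>K > 0\<close> by (simp add: field_simps)
    have "\<bar>s - t\<bar> < d" using that by simp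
    from C d(2)[OF that(1) this] show ?thesis
    proof eventually_elim
      case (elim x)
      have "\<bar>(s - t) * v' t x\<bar> \<le> \<bar>s - t\<bar> * \<bar>C\<bar>"
        unfolding abs_mult using elim by (intro mult_left_mono) auto
      then have "\<bar>v s x - v t x\<bar> \<le> \<bar>s - t\<bar> * K"
        using elim by (simp add: K_def distrib_left)
      with le show ?case by linarith
    qed
  qed
  then show "\<exists>d>0. \<forall>s\<ge>0. \<bar>s - t\<bar> < d \<longrightarrow> (AE x in M. \<bar>v s x - v t x\<bar> \<le> e)"
    using d(1) \<open>e > 0\<close> \<open>K > 0\<close> by (intro exI[of _ "min d (e / K)"]) auto
qed

lemma Linf_continuous_compose:
  assumes v: "Linf_continuous M v" and bdd: "\<And>t. t \<ge> 0 \<Longrightarrow> \<exists>C. AE x in M. \<bar>v t x\<bar> \<le> C"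
    and h: "continuous_on UNIV h"
  shows "Linf_continuous M (\<lambda>t x. h (v t x) :: real)"
  unfolding Linf_continuous_def
proof (intro allI impI)
  fix t e :: real assume "t \<ge> 0" "e > 0"
  obtain C where C: "AE x in M. \<bar>v t x\<bar> \<le> C"
    using bdd \<open>t \<ge> 0\<close> by blast
  \<comment> \<open>The range \<open>{-C..C}\<close> of \<open>v t\<close> is widened by
    \<open>1\<close> so that it also contains \<open>v s x\<close> for nearby \<open>s\<close>. This
    is why \<open>k'\<close> below is at most \<open>1\<close>; halving \<open>k\<close> gives the
    strict inequality.\<close>
  have "uniformly_continuous_on {-C-1..C+1} h"
    using h by (intro compact_uniformly_continuous) (auto intro: continuous_on_subset)
  then obtain k where k: "k > 0" "\<And>y z. y \<in> {-C-1..C+1} \<Longrightarrow> z \<in> {-C-1..C+1} \<Longrightarrow>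
      dist y z < k \<Longrightarrow> dist (h y) (h z) < e"
    unfolding uniformly_continuous_on_def using \<open>e > 0\<close> by blast
  define k' where "k' = min 1 (k / 2)"
  have "k' > 0" using k by (simp add: k'_def)
  then obtain d where d: "d > 0"
    "\<And>s. s \<ge> 0 \<Longrightarrow> \<bar>s - t\<bar> < d \<Longrightarrow> AE x in M. \<bar>v s x - v t x\<bar> \<le> k'"
    using v[unfolded Linf_continuous_def, rule_format, OF \<open>t \<ge> 0\<close> \<open>k' > 0\<close>] by blast
  have "AE x in M. \<bar>h (v s x) - h (v t x)\<bar> \<le> e" if "s \<ge> 0" "\<bar>s - t\<bar> < d" for s
    using C d(2)[OF that]
  proof eventually_elim
    case (elim x)
    then have "v s x \<in> {-C-1..C+1}" "v t x \<in> {-C-1..C+1}" "dist (v s x) (v t x) < k"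
      using k(1) by (auto simp: k'_def dist_real_def)
    then show ?case
      using k(2) by (force simp: dist_real_def)
  qed
  then show "\<exists>d>0. \<forall>s\<ge>0. \<bar>s - t\<bar> < d \<longrightarrow> (AE x in M. \<bar>h (v s x) - h (v t x)\<bar> \<le> e)"
    using d(1) by blast
qed

section \<open>Integrals and mean value estimates over a finite measure\<close>

context finite_measure
begin

lemma abs_integral_le:
  fixes h :: "'a \<Rightarrow> real"
  assumes "AE x in M. \<bar>h x\<bar> \<le> c" "c \<ge> 0"
  shows "\<bar>\<integral>x. h x \<partial>M\<bar> \<le> c * measure M (space M)"
proof -
  have "\<bar>\<integral>x. h x \<partial>M\<bar> \<le> (\<integral>x. \<bar>h x\<bar> \<partial>M)"
    by (rule integral_abs_bound)
  also have "\<dots> \<le> (\<integral>x. c \<partial>M)"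
    using assms by (intro integral_mono_AE') auto
  finally show ?thesis by (simp add: mult.commute)
qed

lemma continuous_on_integral_Linf:
  assumes v: "Linf_continuous M v" and int: "\<And>t. t \<ge> 0 \<Longrightarrow> integrable M (v t)"
  shows "continuous_on {0..} (\<lambda>t. \<integral>x. v t x \<partial>M)"
  unfolding continuous_on_iff
proof (intro ballI allI impI)
  fix t e :: real assume t: "t \<in> {0..}" and "e > 0"
  \<comment> \<open>Adding \<open>1\<close> keeps \<open>m\<close> positive when the measure
    vanishes and makes the final estimate strict.\<close>
  define m where "m = measure M (space M) + 1"
  have m: "m > 0" by (simp add: m_def add_nonneg_pos)
  with \<open>e > 0\<close> have "e / m > 0" by simp
  then obtain d where d: "d > 0"
    "\<And>s. s \<ge> 0 \<Longrightarrow> \<bar>s - t\<bar> < d \<Longrightarrow> AE x in M. \<bar>v s x - v t x\<bar> \<le> e / m"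
    using v[unfolded Linf_continuous_def, rule_format, OF _ \<open>e / m > 0\<close>, of t] t by auto
  have "\<bar>(\<integral>x. v s x \<partial>M) - (\<integral>x. v t x \<partial>M)\<bar> < e" if "s \<ge> 0" "\<bar>s - t\<bar> < d" for s
  proof -
    have "(\<integral>x. v s x \<partial>M) - (\<integral>x. v t x \<partial>M) = (\<integral>x. v s x - v t x \<partial>M)"
      using int that t by simp
    also have "\<bar>\<dots>\<bar> \<le> e / m * measure M (space M)"
      using d(2)[OF that] \<open>e / m > 0\<close> by (intro abs_integral_le) auto
    also have "\<dots> < e / m * m"
      using \<open>e / m > 0\<close> by (intro mult_strict_left_mono) (auto simp: m_def)
    finally show ?thesis using m by simp
  qed
  then show "\<exists>d>0. \<forall>s\<in>{0..}. dist s t < d \<longrightarrow> dist (\<integral>x. v s x \<partial>M) (\<integral>x. v t x \<partial>M) < e"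
    using d(1) by (auto simp: dist_real_def)
qed

text \<open>\<open>L\<^sup>\<infinity>\<close>-valued mean value estimates are reduced to the scalar mean value theorem by integrating
  over the set where the estimate fails.\<close>

lemma Linf_derivative_le:
  assumes v: "Linf_derivative M v v'"
    and int: "\<And>t. t \<ge> 0 \<Longrightarrow> integrable M (v t)" "\<And>t. t \<ge> 0 \<Longrightarrow> integrable M (v' t)"
    and "0 \<le> p" "p < q" and c: "integrable M c"
    and le: "\<And>s. p < s \<Longrightarrow> s < q \<Longrightarrow> AE x in M. v' s x \<le> c x"
  shows "AE x in M. v q x - v p x \<le> (q - p) * c x"
proof -
  have "q \<ge> 0" using assms by simp
  have [measurable]: "v p \<in> borel_measurable M" "v q \<in> borel_measurable M" "c \<in> borel_measurable M"
    using int(1)[OF \<open>0 \<le> p\<close>] int(1)[OF \<open>0 \<le> q\<close>] c by auto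
  define A where "A = {x \<in> space M. (q - p) * c x < v q x - v p x}"
  have A [measurable]: "A \<in> sets M" by (simp add: A_def)
  define F where "F t = (\<integral>x. v t x * indicator A x \<partial>M)" for t
  define F' where "F' t = (\<integral>x. v' t x * indicator A x \<partial>M)" for t
  have intA: "integrable M (\<lambda>x. v t x * indicator A x)" "integrable M (\<lambda>x. v' t x * indicator A x)"
    if "t \<ge> 0" for t
    using int that by (auto intro: integrable_real_mult_indicator)
  have cA: "integrable M (\<lambda>x. c x * indicator A x)"
    using c by (auto intro: integrable_real_mult_indicator)
  \<comment> \<open>Integration over \<open>A\<close> is a bounded functional on L-infinity, because
    \<open>M\<close> is finite, and hence commutes with the time derivative.\<close>
  have deriv: "(F has_derivative (*) (F' t)) (at t within {0..})" if "t \<ge> 0" for t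
    unfolding has_derivative_within_alt
  proof (intro conjI bounded_linear_mult_right allI impI)
    fix e :: real assume "e > 0"
    define m where "m = measure M (space M) + 1"
    have m: "m > 0" by (simp add: m_def add_nonneg_pos)
    with \<open>e > 0\<close> have "e / m > 0" by simp
    then obtain d where d: "d > 0" "\<And>s. s \<ge> 0 \<Longrightarrow> \<bar>s - t\<bar> < d \<Longrightarrow>
        AE x in M. \<bar>v s x - v t x - (s - t) * v' t x\<bar> \<le> e / m * \<bar>s - t\<bar>"
      using v[unfolded Linf_derivative_def, rule_format, OF \<open>t \<ge> 0\<close> \<open>e / m > 0\<close>] by blast
    have "\<bar>F s - F t - F' t * (s - t)\<bar> \<le> e * \<bar>s - t\<bar>" if s: "s \<ge> 0" "\<bar>s - t\<bar> < d" for s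
    proof -
      define k where "k = e / m * \<bar>s - t\<bar>"
      have "k \<ge> 0"
        unfolding k_def using \<open>e / m > 0\<close> by (intro mult_nonneg_nonneg) auto
      have "F s - F t - F' t * (s - t) =
          (\<integral>x. v s x * indicator A x - v t x * indicator A x - v' t x * indicator A x * (s - t) \<partial>M)"
        unfolding F_def F'_def using intA s \<open>t \<ge> 0\<close> by simp
      also have "\<bar>\<dots>\<bar> \<le> k * measure M (space M)"
      proof (rule abs_integral_le[OF _ \<open>k \<ge> 0\<close>])
        show "AE x in M. \<bar>v s x * indicator A x - v t x * indicator A x - v' t x * indicator A x * (s - t)\<bar> \<le> k"
          using d(2)[OF s, folded k_def]
          by eventually_elim (use \<open>k \<ge> 0\<close> in \<open>auto simp: indicator_def mult.commute\<close>)
      qed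
      also have "\<dots> \<le> k * m"
        using \<open>k \<ge> 0\<close> by (intro mult_left_mono) (auto simp: m_def)
      finally show ?thesis using m by (simp add: k_def)
    qed
    then show "\<exists>d>0. \<forall>y\<in>{0..}. norm (y - t) < d \<longrightarrow> norm (F y - F t - F' t * (y - t)) \<le> e * norm (y - t)"
      using d(1) by auto
  qed
  obtain s where s: "p < s" "s < q" "F q - F p = F' s * (q - p)"
  proof -
    have "(F has_derivative (*) (F' t)) (at t within {p..q})" if "p \<le> t" "t \<le> q" for t
      using deriv[of t] that \<open>0 \<le> p\<close> by (auto intro: has_derivative_subset)
    from mvt_simple[OF \<open>p < q\<close> this] that show ?thesis by auto
  qed
  have "s \<ge> 0" using s \<open>0 \<le> p\<close> by simp
  have "F' s \<le> (\<integral>x. c x * indicator A x \<partial>M)"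
    unfolding F'_def using intA(2)[OF \<open>s \<ge> 0\<close>] cA
  proof (rule integral_mono_AE)
    show "AE x in M. v' s x * indicator A x \<le> c x * indicator A x"
      using le[OF s(1,2)] by eventually_elim (auto simp: indicator_def)
  qed
  then have F_le: "F q - F p \<le> (\<integral>x. c x * indicator A x \<partial>M) * (q - p)"
    unfolding s(3) using \<open>p < q\<close> by (intro mult_right_mono) auto
  \<comment> \<open>By the choice of \<open>A\<close>, \<open>h\<close> is nonnegative everywhere
    and strictly positive on \<open>A\<close>. As its integral is at most \<open>0\<close>, it
    vanishes almost everywhere, and \<open>A\<close> is null.\<close>
  define h where "h x = v q x * indicator A x - v p x * indicator A x - c x * indicator A x * (q - p)" for x
  have h_int: "integrable M h"
    unfolding h_def using intA \<open>0 \<le> p\<close> \<open>0 \<le> q\<close> cA by auto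
  have h_nonneg: "h x \<ge> 0" for x
    by (auto simp: h_def A_def indicator_def mult.commute)
  have "(\<integral>x. h x \<partial>M) = F q - F p - (\<integral>x. c x * indicator A x \<partial>M) * (q - p)"
    unfolding h_def F_def using intA \<open>0 \<le> p\<close> \<open>0 \<le> q\<close> cA by simp
  with F_le have "(\<integral>x. h x \<partial>M) = 0"
    using Bochner_Integration.integral_nonneg[of M h] h_nonneg by (simp add: order_antisym)
  then have "AE x in M. h x = 0"
    using integral_nonneg_eq_0_iff_AE[OF h_int] h_nonneg by simp
  with AE_space show ?thesis
  proof eventually_elim
    case (elim x)
    show ?case
    proof (rule ccontr)
      assume *: "\<not> ?thesis"
      then have "x \<in> A" using elim by (simp add: A_def)
      with elim * show False by (simp add: h_def mult.commute)
    qed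
  qed
qed

text \<open>The two one-sided bounds come from \<open>Linf_derivative_le\<close>, applied to
  \<open>v\<close> and to \<open>- v\<close>. The reference time \<open>r\<close> is independent of
  the interval, so that either endpoint can serve later.\<close>

lemma Linf_mean_value:
  assumes v: "Linf_derivative M v v'"
    and int: "\<And>t. t \<ge> 0 \<Longrightarrow> integrable M (v t)" "\<And>t. t \<ge> 0 \<Longrightarrow> integrable M (v' t)"
    and "0 \<le> p" "p < q" "0 \<le> r"
    and le: "\<And>s. p < s \<Longrightarrow> s < q \<Longrightarrow> AE x in M. \<bar>v' s x - v' r x\<bar> \<le> e"
  shows "AE x in M. \<bar>v q x - v p x - (q - p) * v' r x\<bar> \<le> e * (q - p)"
proof -
  have "AE x in M. v q x - v p x \<le> (q - p) * (v' r x + e)"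
  proof (rule Linf_derivative_le[OF v int \<open>0 \<le> p\<close> \<open>p < q\<close>])
    show "AE x in M. v' s x \<le> v' r x + e" if "p < s" "s < q" for s
      using le[OF that] by eventually_elim linarith
  qed (use int \<open>0 \<le> r\<close> in auto)
  moreover have "AE x in M. - v q x - - v p x \<le> (q - p) * (- v' r x + e)"
  proof (rule Linf_derivative_le[OF _ _ _ \<open>0 \<le> p\<close> \<open>p < q\<close>])
    have "\<bar>- a - - b - k * - c\<bar> = \<bar>a - b - k * c\<bar>" for a b c k :: real
      by simp
    then show "Linf_derivative M (\<lambda>t x. - v t x) (\<lambda>t x. - v' t x)"
      using v by (simp only: Linf_derivative_def)
    show "AE x in M. - v' s x \<le> - v' r x + e" if "p < s" "s < q" for s
      using le[OF that] by eventually_elim linarith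
  qed (use int \<open>0 \<le> r\<close> in auto)
  ultimately show ?thesis
    by eventually_elim (simp add: algebra_simps abs_le_iff)
qed

text \<open>For almost every \<open>x\<close>, the mean value estimate holds for all pairs of
  rational times, with remainders controlled by the modulus of \<open>v'\<close>. Continuity of
  \<open>w\<close> and \<open>w'\<close> carries it to all real times, where it is the definition of
  the derivative.\<close>

lemma representative_has_derivative:
  assumes v: "Linf_derivative M v v'" and v': "Linf_continuous M v'"
    and int: "\<And>t. t \<ge> 0 \<Longrightarrow> integrable M (v t)" "\<And>t. t \<ge> 0 \<Longrightarrow> integrable M (v' t)"
    and eq: "\<And>t. t \<ge> 0 \<Longrightarrow> AE x in M. w t x = v t x" "\<And>t. t \<ge> 0 \<Longrightarrow> AE x in M. w' t x = v' t x"
    and cont: "\<And>x. continuous_on {0..} (\<lambda>t. w t x)" "\<And>x. continuous_on {0..} (\<lambda>t. w' t x)"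
  shows "AE x in M. \<forall>t\<ge>0. ((\<lambda>t. w t x) has_real_derivative w' t x) (at t within {0..})"
proof -
  obtain d where "\<forall>n m. d n m > (0::real) \<and> (\<forall>s\<in>{0..real n}. \<forall>t\<in>{0..real n}.
      \<bar>s - t\<bar> < d n m \<longrightarrow> (AE x in M. \<bar>v' s x - v' t x\<bar> \<le> inverse (Suc m)))"
    using Linf_continuous_modulus[OF v'] by blast
  then have d: "d n m > 0"
    "0 \<le> s \<Longrightarrow> s \<le> real n \<Longrightarrow> 0 \<le> t \<Longrightarrow> t \<le> real n \<Longrightarrow> \<bar>s - t\<bar> < d n m \<Longrightarrow>
      AE x in M. \<bar>v' s x - v' t x\<bar> \<le> inverse (Suc m)" for n m s t
    by auto
  have "AE x in M. \<forall>n m. \<forall>p\<in>\<rat>. \<forall>q\<in>\<rat>. p \<ge> 0 \<longrightarrow> q \<ge> 0 \<longrightarrow>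
    p \<le> real n \<longrightarrow> q \<le> real n \<longrightarrow> \<bar>q - p\<bar> < d n m \<longrightarrow>
    \<bar>v q x - v p x - (q - p) * v' p x\<bar> \<le> inverse (Suc m) * \<bar>q - p\<bar>"
    unfolding AE_all_countable
  proof (intro allI AE_rational_pairs)
    fix n m and p q :: real assume pq: "p \<ge> 0" "q \<ge> 0"
    show "AE x in M. p \<le> real n \<longrightarrow> q \<le> real n \<longrightarrow> \<bar>q - p\<bar> < d n m \<longrightarrow>
        \<bar>v q x - v p x - (q - p) * v' p x\<bar> \<le> inverse (Suc m) * \<bar>q - p\<bar>"
    proof (cases "p \<le> real n \<and> q \<le> real n \<and> \<bar>q - p\<bar> < d n m")
      case True
      \<comment> \<open>With \<open>min\<close> and \<open>max\<close> both orders of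
        \<open>p\<close> and \<open>q\<close> are covered. The derivative is always taken at
        \<open>p\<close>, which may be the left or the right endpoint.\<close>
      have *: "AE x in M. \<bar>v' s x - v' p x\<bar> \<le> inverse (Suc m)" if "min p q < s" "s < max p q" for s
        using that True pq by (intro d(2)[of s n p m]) auto
      consider "p < q" | "q < p" | "p = q" by linarith
      then have "AE x in M. \<bar>v q x - v p x - (q - p) * v' p x\<bar> \<le> inverse (Suc m) * \<bar>q - p\<bar>"
      proof cases
        case 1
        then show ?thesis
          using Linf_mean_value[OF v int pq(1) 1 pq(1) *] by simp
      next
        case 2
        have "AE x in M. \<bar>v p x - v q x - (p - q) * v' p x\<bar> \<le> inverse (Suc m) * (p - q)"
          using 2 by (intro Linf_mean_value[OF v int pq(2) 2 pq(1) *]) auto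
        then show ?thesis
        proof eventually_elim
          case (elim x)
          have "v q x - v p x - (q - p) * v' p x = - (v p x - v q x - (p - q) * v' p x)"
            by (simp add: algebra_simps)
          with elim 2 show ?case
            by (simp only: abs_minus_cancel) simp
        qed
      qed auto
      then show ?thesis by eventually_elim blast
    qed auto
  qed
  moreover have "AE x in M. \<forall>p\<in>\<rat>. p \<ge> 0 \<longrightarrow> w p x = v p x \<and> w' p x = v' p x"
  proof (intro AE_ball_countable' countable_rat)
    fix p :: real
    show "AE x in M. p \<ge> 0 \<longrightarrow> w p x = v p x \<and> w' p x = v' p x"
    proof (cases "p \<ge> 0")
      case True
      show ?thesis using eq(1)[OF True] eq(2)[OF True] by eventually_elim simp
    qed auto
  qed
  ultimately show ?thesis
  proof eventually_elim
    case (elim x)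
    define r where "r = rational_below"
    have r: "r t k \<in> \<rat>" "r t k \<ge> 0" "r t k \<le> t" "r t \<longlonglongrightarrow> t" if "t \<ge> 0" for t k
      unfolding r_def using rational_below[OF that] by auto
    have lim: "(\<lambda>k. w (r t k) x) \<longlonglongrightarrow> w t x" "(\<lambda>k. w' (r t k) x) \<longlonglongrightarrow> w' t x" if "t \<ge> 0" for t
      using that r[OF that]
      by (auto intro!: continuous_on_tendsto_compose[OF cont(1)] continuous_on_tendsto_compose[OF cont(2)])
    \<comment> \<open>Only rational times are evaluated before the limit, and there \<open>w\<close>
      and \<open>w'\<close> agree with \<open>v\<close> and \<open>v'\<close> outside a single null
      set.\<close>
    have est: "\<bar>w s x - w t x - (s - t) * w' t x\<bar> \<le> inverse (Suc m) * \<bar>s - t\<bar>"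
      if st: "0 \<le> s" "s \<le> real n" "0 \<le> t" "t \<le> real n" "\<bar>s - t\<bar> < d n m" for s t n m
    proof (rule tendsto_le)
      show "(\<lambda>k. \<bar>w (r s k) x - w (r t k) x - (r s k - r t k) * w' (r t k) x\<bar>) \<longlonglongrightarrow>
          \<bar>w s x - w t x - (s - t) * w' t x\<bar>"
        using st by (intro tendsto_intros lim r(4))
      show "(\<lambda>k. inverse (Suc m) * \<bar>r s k - r t k\<bar>) \<longlonglongrightarrow> inverse (Suc m) * \<bar>s - t\<bar>"
        using st by (intro tendsto_intros r(4))
      have "(\<lambda>k. \<bar>r s k - r t k\<bar>) \<longlonglongrightarrow> \<bar>s - t\<bar>"
        using st by (intro tendsto_intros r(4))
      then have "\<forall>\<^sub>F k in sequentially. \<bar>r s k - r t k\<bar> < d n m"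
        using st(5) by (rule order_tendstoD)
      then show "\<forall>\<^sub>F k in sequentially. \<bar>w (r s k) x - w (r t k) x - (r s k - r t k) * w' (r t k) x\<bar>
          \<le> inverse (Suc m) * \<bar>r s k - r t k\<bar>"
      proof eventually_elim
        case k: (elim k)
        have "r s k \<le> real n" "r t k \<le> real n"
          using r(3)[OF st(1)] r(3)[OF st(3)] st by (meson order_trans)+
        then have "\<bar>v (r s k) x - v (r t k) x - (r s k - r t k) * v' (r t k) x\<bar>
            \<le> inverse (Suc m) * \<bar>r s k - r t k\<bar>"
          using elim(1) k r(1,2)[OF st(1)] r(1,2)[OF st(3)] by blast
        then show ?case
          using elim(2) r(1,2)[OF st(1)] r(1,2)[OF st(3)] by simp
      qed
    qed simp
    show ?case
      unfolding has_field_derivative_def has_derivative_within_alt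
    proof (intro allI impI conjI bounded_linear_mult_right)
      fix t e :: real assume t: "t \<ge> 0" and "e > 0"
      then obtain m where m: "inverse (real (Suc m)) < e"
        using reals_Archimedean by blast
      obtain n where n: "t + 1 \<le> real n"
        using real_arch_simple by blast
      have "\<bar>w s x - w t x - w' t x * (s - t)\<bar> \<le> e * \<bar>s - t\<bar>"
        if "s \<ge> 0" "\<bar>s - t\<bar> < min 1 (d n m)" for s
      proof -
        have "s \<le> real n" "t \<le> real n"
          using that n by linarith+
        have "\<bar>w s x - w t x - w' t x * (s - t)\<bar> \<le> inverse (Suc m) * \<bar>s - t\<bar>"
          using est[of s n t m] that t \<open>s \<le> real n\<close> \<open>t \<le> real n\<close> by (auto simp: mult.commute)
        also have "\<dots> \<le> e * \<bar>s - t\<bar>"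
          using m by (intro mult_right_mono) auto
        finally show ?thesis .
      qed
      then show "\<exists>d>0. \<forall>y\<in>{0..}. norm (y - t) < d \<longrightarrow>
          norm (w y x - w t x - w' t x * (y - t)) \<le> e * norm (y - t)"
        using d(1)[of n m] by (intro exI[of _ "min 1 (d n m)"]) auto
    qed
  qed
qed

end

section \<open>From the essential supremum norm to almost everywhere estimates\<close>

lemma AE_le_of_Linf_norm:
  assumes "Linf_norm \<Omega> v \<le> ennreal e" "e \<ge> 0"
  shows "AE x in lebesgue_on \<Omega>. \<bar>v x\<bar> \<le> e"
  using esssup_AE[of "\<lambda>x. ennreal \<bar>v x\<bar>" "lebesgue_on \<Omega>"]
proof eventually_elim
  case (elim x)
  then have "ennreal \<bar>v x\<bar> \<le> ennreal e"
    using assms(1) unfolding Linf_norm_def by (rule order_trans)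
  then show ?case using assms(2) by simp
qed

lemma Linf_bounded:
  assumes "v \<in> Linf \<Omega>"
  shows "\<exists>C. AE x in lebesgue_on \<Omega>. \<bar>v x\<bar> \<le> C"
proof -
  have "Linf_norm \<Omega> v < top"
    using assms by (simp add: Linf_def)
  then have "Linf_norm \<Omega> v \<le> ennreal (enn2real (Linf_norm \<Omega> v))"
    by simp
  then show ?thesis
    by (blast intro: AE_le_of_Linf_norm enn2real_nonneg)
qed

lemma C1_Linf_imp:
  assumes "C1_Linf \<Omega> u u'"
  shows "Linf_derivative (lebesgue_on \<Omega>) u u'" "Linf_continuous (lebesgue_on \<Omega>) u'"
proof -
  show "Linf_derivative (lebesgue_on \<Omega>) u u'"
    unfolding Linf_derivative_def
  proof (intro allI impI)
    fix t e :: real assume t: "t \<ge> 0" and e: "e > 0"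
    have "((\<lambda>s. Linf_norm \<Omega> (\<lambda>x. (u s x - u t x) / (s - t) - u' t x)) \<longlongrightarrow> 0) (at t within {0..})"
      using assms t by (simp add: C1_Linf_def)
    then have "\<forall>\<^sub>F s in at t within {0..}. Linf_norm \<Omega> (\<lambda>x. (u s x - u t x) / (s - t) - u' t x) < ennreal e"
      by (rule order_tendstoD) (use e in simp)
    then obtain d where d: "d > 0" "\<And>s. s \<ge> 0 \<Longrightarrow> s \<noteq> t \<Longrightarrow> \<bar>s - t\<bar> < d \<Longrightarrow>
        Linf_norm \<Omega> (\<lambda>x. (u s x - u t x) / (s - t) - u' t x) < ennreal e"
      unfolding eventually_at by (auto simp: dist_real_def)
    have "AE x in lebesgue_on \<Omega>. \<bar>u s x - u t x - (s - t) * u' t x\<bar> \<le> e * \<bar>s - t\<bar>"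
      if s: "s \<ge> 0" "\<bar>s - t\<bar> < d" for s
    proof (cases "s = t")
      case False
      have "AE x in lebesgue_on \<Omega>. \<bar>(u s x - u t x) / (s - t) - u' t x\<bar> \<le> e"
        using d(2)[OF s(1) False s(2)] e by (intro AE_le_of_Linf_norm) auto
      then show ?thesis
      proof eventually_elim
        case (elim x)
        have "u s x - u t x - (s - t) * u' t x = ((u s x - u t x) / (s - t) - u' t x) * (s - t)"
          using False by (simp add: field_simps)
        with elim show ?case
          by (simp add: abs_mult mult_right_mono)
      qed
    qed auto
    with d(1) show "\<exists>d>0. \<forall>s\<ge>0. \<bar>s - t\<bar> < d \<longrightarrow>
        (AE x in lebesgue_on \<Omega>. \<bar>u s x - u t x - (s - t) * u' t x\<bar> \<le> e * \<bar>s - t\<bar>)"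
      by blast
  qed
  show "Linf_continuous (lebesgue_on \<Omega>) u'"
    unfolding Linf_continuous_def
  proof (intro allI impI)
    fix t e :: real assume t: "t \<ge> 0" and e: "e > 0"
    have "((\<lambda>s. Linf_norm \<Omega> (\<lambda>x. u' s x - u' t x)) \<longlongrightarrow> 0) (at t within {0..})"
      using assms t by (simp add: C1_Linf_def)
    then have "\<forall>\<^sub>F s in at t within {0..}. Linf_norm \<Omega> (\<lambda>x. u' s x - u' t x) < ennreal e"
      by (rule order_tendstoD) (use e in simp)
    then obtain d where d: "d > 0" "\<And>s. s \<ge> 0 \<Longrightarrow> s \<noteq> t \<Longrightarrow> \<bar>s - t\<bar> < d \<Longrightarrow>
        Linf_norm \<Omega> (\<lambda>x. u' s x - u' t x) < ennreal e"
      unfolding eventually_at by (auto simp: dist_real_def)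
    have "AE x in lebesgue_on \<Omega>. \<bar>u' s x - u' t x\<bar> \<le> e" if s: "s \<ge> 0" "\<bar>s - t\<bar> < d" for s
    proof (cases "s = t")
      case False
      then show ?thesis
        using d(2)[OF s(1) False s(2)] e by (intro AE_le_of_Linf_norm) auto
    qed (use e in auto)
    with d(1) show "\<exists>d>0. \<forall>s\<ge>0. \<bar>s - t\<bar> < d \<longrightarrow> (AE x in lebesgue_on \<Omega>. \<bar>u' s x - u' t x\<bar> \<le> e)"
      by blast
  qed
qed

section \<open>The scalar equation\<close>

text \<open>Multiplication by the integrating factor makes \<open>y\<close> constant. The explicit
  formula is used for signs: the solution keeps the sign of its initial value.\<close>

lemma linear_ode_solution:
  fixes a y :: "real \<Rightarrow> real"
  assumes a: "continuous_on {0..} a"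
    and y: "\<And>t. t \<ge> 0 \<Longrightarrow> (y has_real_derivative a t * y t) (at t within {0..})"
    and "t \<ge> 0"
  shows "y t = y 0 * exp (integral {0..t} a)"
proof -
  define z where "z s = y s * exp (- integral {0..s} a)" for s
  have a': "continuous_on {0..t} a"
    using a by (rule continuous_on_subset) auto
  have "(z has_real_derivative 0) (at s within {0..t})" if "s \<in> {0..t}" for s
  proof -
    have "(y has_real_derivative a s * y s) (at s within {0..t})"
      using y[of s] that by (auto intro: DERIV_subset)
    with integral_has_real_derivative[OF a' that] show ?thesis
      unfolding z_def by (auto intro!: derivative_eq_intros)
  qed
  then obtain c where "\<And>s. s \<in> {0..t} \<Longrightarrow> z s = c"
    using has_field_derivative_zero_constant[of "{0..t}" z] by auto
  then have "z t = z 0"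
    using \<open>t \<ge> 0\<close> by auto
  then show ?thesis
    by (simp add: z_def exp_minus field_simps)
qed

text \<open>\<open>B\<close> is nondecreasing and bounded, so it has only finite growth left. If
  \<open>H\<close> reaches \<open>e\<close>, the one-sided Lipschitz bound keeps it above
  \<open>e / 2\<close> for a fixed time, and \<open>B\<close> gains a fixed amount; this is
  impossible at late times.\<close>

lemma barbalat:
  fixes B H :: "real \<Rightarrow> real"
  assumes B: "\<And>t. t \<ge> 0 \<Longrightarrow> (B has_real_derivative B' t) (at t within {0..})"
    and ge: "\<And>t. t \<ge> 0 \<Longrightarrow> c * H t \<le> B' t" and "c > 0"
    and bdd: "\<And>t. t \<ge> 0 \<Longrightarrow> B t \<le> C"
    and H: "\<And>t. t \<ge> 0 \<Longrightarrow> H t \<ge> 0"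
    and Lip: "\<And>s t. 0 \<le> t \<Longrightarrow> t \<le> s \<Longrightarrow> H t - K * (s - t) \<le> H s" and "K > 0"
  shows "(H \<longlongrightarrow> 0) at_top"
proof -
  have mvt: "\<exists>x\<in>{s<..<t}. B t - B s = B' x * (t - s)" if "0 \<le> s" "s < t" for s t
  proof (rule mvt_simple[OF \<open>s < t\<close>])
    show "(B has_derivative (*) (B' x)) (at x within {s..t})" if "s \<le> x" "x \<le> t" for x
      using B[of x] that \<open>0 \<le> s\<close>
      by (auto simp: has_field_derivative_def intro: has_derivative_subset)
  qed
  have mono: "B s \<le> B t" if "0 \<le> s" "s \<le> t" for s t
  proof (cases "s = t")
    case False
    with that obtain x where x: "x \<in> {s<..<t}" "B t - B s = B' x * (t - s)"
      using mvt[of s t] by auto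
    have "B' x \<ge> 0"
      using ge[of x] H[of x] x \<open>c > 0\<close> that
      by (smt (verit) greaterThanLessThan_iff mult_nonneg_nonneg)
    then have "B' x * (t - s) \<ge> 0"
      using that by simp
    with x show ?thesis by linarith
  qed auto
  define L where "L = (SUP t\<in>{0..}. B t)"
  have bdd': "bdd_above (B ` {0..})"
    using bdd by (auto intro!: bdd_aboveI)
  have le_L: "B t \<le> L" if "t \<ge> 0" for t
    unfolding L_def using that bdd' by (auto intro: cSUP_upper)
  show ?thesis
  proof (rule tendstoI)
    fix e :: real assume "e > 0"
    \<comment> \<open>In time \<open>h\<close> the value of \<open>H\<close> can fall from
      \<open>e\<close> to \<open>e / 2\<close> but no lower. After \<open>T\<close>, chosen below,
      \<open>B\<close> has less than \<open>c * (e / 2) * h\<close> left to gain.\<close>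
    define h where "h = e / (2 * K)"
    have "h > 0" using \<open>e > 0\<close> \<open>K > 0\<close> by (simp add: h_def)
    have "L - c * (e / 2) * h < L"
      using \<open>e > 0\<close> \<open>h > 0\<close> \<open>c > 0\<close> by simp
    then obtain T where T: "T \<ge> 0" "L - c * (e / 2) * h < B T"
      unfolding L_def using less_cSUP_iff[OF _ bdd'] by auto
    have "H t < e" if "t \<ge> T" for t
    proof (rule ccontr)
      assume "\<not> H t < e"
      have "t \<ge> 0" using that T by simp
      obtain x where x: "t < x" "x < t + h" "B (t + h) - B t = B' x * h"
        using mvt[of t "t + h"] \<open>t \<ge> 0\<close> \<open>h > 0\<close> by auto
      have "K * (x - t) \<le> K * h"
        using x \<open>K > 0\<close> by (intro mult_left_mono) auto
      also have "K * h = e / 2"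
        using \<open>K > 0\<close> by (simp add: h_def)
      finally have "e / 2 \<le> H x"
        using Lip[of t x] x \<open>t \<ge> 0\<close> \<open>\<not> H t < e\<close> by linarith
      then have "c * (e / 2) \<le> B' x"
        using ge[of x] x \<open>t \<ge> 0\<close> \<open>c > 0\<close> by (smt (verit) mult_left_mono)
      then have "c * (e / 2) * h \<le> B' x * h"
        using \<open>h > 0\<close> by (intro mult_right_mono) auto
      with x T mono[of T t] le_L[of "t + h"] that \<open>t \<ge> 0\<close> \<open>h > 0\<close> show False
        by linarith
    qed
    then show "\<forall>\<^sub>F t in at_top. dist (H t) 0 < e"
      using H T(1) by (auto simp: eventually_at_top_linorder intro!: exI[of _ T])
  qed
qed

text \<open>The right-hand side is \<open>y (1 - y) (y - l)\<close>, so \<open>y\<close> and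
  \<open>1 - y\<close> both solve homogeneous linear equations, and \<open>a\<close> and
  \<open>b\<close> are exponentials. Hence \<open>0\<close> and \<open>1\<close> are stationary, and
  both the open and the closed unit interval are invariant.\<close>

lemma reaction_solution_factor:
  fixes y l :: "real \<Rightarrow> real"
  assumes l: "continuous_on {0..} l"
    and y: "\<And>t. t \<ge> 0 \<Longrightarrow>
      (y has_real_derivative f_react (y t) - l t * g_react (y t)) (at t within {0..})"
    and "t \<ge> 0"
  shows "\<exists>a>0. \<exists>b>0. y t = y 0 * a \<and> 1 - y t = (1 - y 0) * b"
proof -
  have cont: "continuous_on {0..} y"
    using y by (intro DERIV_continuous_on) auto
  have "y t = y 0 * exp (integral {0..t} (\<lambda>t. (1 - y t) * (y t - l t)))"
  proof (rule linear_ode_solution[OF _ _ \<open>t \<ge> 0\<close>])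
    show "continuous_on {0..} (\<lambda>t. (1 - y t) * (y t - l t))"
      using cont l by (intro continuous_intros)
    show "(y has_real_derivative (1 - y s) * (y s - l s) * y s) (at s within {0..})"
      if "s \<ge> 0" for s
      using y[OF that] by (simp add: f_react_def g_react_def algebra_simps power2_eq_square)
  qed
  moreover have "1 - y t = (1 - y 0) * exp (integral {0..t} (\<lambda>t. - y t * (y t - l t)))"
  proof (rule linear_ode_solution[OF _ _ \<open>t \<ge> 0\<close>])
    show "continuous_on {0..} (\<lambda>t. - y t * (y t - l t))"
      using cont l by (intro continuous_intros)
    show "((\<lambda>s. 1 - y s) has_real_derivative - y s * (y s - l s) * (1 - y s)) (at s within {0..})"
      if "s \<ge> 0" for s
      using y[OF that]
      by (auto intro!: derivative_eq_intros
          simp: f_react_def g_react_def algebra_simps power2_eq_square)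
  qed
  ultimately show ?thesis
    using exp_gt_zero by blast
qed

lemma g_react_bounds:
  assumes "0 \<le> z" "z \<le> 1"
  shows "0 \<le> g_react z" "g_react z \<le> 1" "0 \<le> f_react z" "f_react z \<le> g_react z"
proof -
  have "z * z \<le> z"
    using assms by (simp add: mult_left_le)
  moreover have "z * (1 - z) \<le> z" "0 \<le> z * (1 - z)"
    using assms by (auto simp: mult_left_le)
  ultimately show "0 \<le> g_react z" "g_react z \<le> 1"
    using assms by (auto simp: g_react_def)
  show "0 \<le> f_react z" "f_react z \<le> g_react z"
    using assms \<open>z * z \<le> z\<close> by (auto simp: f_react_def g_react_def power2_eq_square intro: mult_right_mono)
qed

text \<open>The coefficient \<open>l\<close> cancels in the difference of the logits, which yields
  the growth needed by \<open>barbalat\<close>. The bounds \<open>l01\<close> enter through the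
  Lipschitz constant of \<open>g(p) g(q)\<close>.\<close>

lemma reaction_pair_tendsto:
  fixes p q l :: "real \<Rightarrow> real"
  assumes l: "continuous_on {0..} l" and l01: "\<And>t. t \<ge> 0 \<Longrightarrow> 0 \<le> l t \<and> l t \<le> 1"
    and p: "\<And>t. t \<ge> 0 \<Longrightarrow>
      (p has_real_derivative f_react (p t) - l t * g_react (p t)) (at t within {0..})"
    and q: "\<And>t. t \<ge> 0 \<Longrightarrow>
      (q has_real_derivative f_react (q t) - l t * g_react (q t)) (at t within {0..})"
    and init: "0 < p 0" "p 0 < q 0" "q 0 < 1"
  shows "((\<lambda>t. g_react (p t) * g_react (q t)) \<longlongrightarrow> 0) at_top"
proof -
  have p01: "0 < p t" "p t < 1" and q01: "0 < q t" "q t < 1" if "t \<ge> 0" for t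
  proof -
    show "0 < p t" "p t < 1"
      using reaction_solution_factor[OF l p that] init
      by (metis diff_gt_0_iff_gt mult_pos_pos less_trans)+
    show "0 < q t" "q t < 1"
      using reaction_solution_factor[OF l q that] init
      by (metis diff_gt_0_iff_gt mult_pos_pos less_trans)+
  qed
  have less: "p t < q t" if "t \<ge> 0" for t
  proof -
    \<comment> \<open>This is the divided difference between \<open>p\<close> and \<open>q\<close>
      of the cubic \<open>- z^3 + (1 + l) z^2 - l z\<close>, the right-hand side of the equation.
      Thus \<open>q - p\<close> solves a linear equation and stays positive.\<close>
    define c where "c t = - ((q t)\<^sup>2 + q t * p t + (p t)\<^sup>2) + (1 + l t) * (q t + p t) - l t" for t
    have "continuous_on {0..} p" "continuous_on {0..} q"
      using p q by (auto intro!: DERIV_continuous_on)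
    then have "continuous_on {0..} c"
      unfolding c_def using l by (intro continuous_intros)
    moreover have "((\<lambda>t. q t - p t) has_real_derivative c s * (q s - p s)) (at s within {0..})"
      if "s \<ge> 0" for s
      using DERIV_diff[OF q p, OF that that]
      by (simp add: c_def f_react_def g_react_def algebra_simps power2_eq_square)
    ultimately have "q t - p t = (q 0 - p 0) * exp (integral {0..t} c)"
      using linear_ode_solution[of c "\<lambda>t. q t - p t"] that by blast
    moreover have "(q 0 - p 0) * exp (integral {0..t} c) > 0"
      using init by simp
    ultimately show ?thesis by linarith
  qed
  define D where "D t = ln (q t) - ln (1 - q t) - (ln (p t) - ln (1 - p t))" for t
  define H where "H t = g_react (p t) * g_react (q t)" for t
  have logit: "((\<lambda>t. ln (y t) - ln (1 - y t)) has_real_derivative y t - l t) (at t within {0..})"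
    if y: "(y has_real_derivative f_react (y t) - l t * g_react (y t)) (at t within {0..})"
      and y01: "0 < y t" "y t < 1" for y t
  proof -
    have *: "f_react (y t) - l t * g_react (y t) = y t * ((1 - y t) * (y t - l t))"
      by (simp add: f_react_def g_react_def algebra_simps power2_eq_square)
    have "((\<lambda>t. ln (y t) - ln (1 - y t)) has_real_derivative
        (1 - y t) * (y t - l t) + y t * (y t - l t)) (at t within {0..})"
      using y01 by (auto intro!: derivative_eq_intros y[unfolded *])
    then show ?thesis
      by (simp add: algebra_simps)
  qed
  have D: "(D has_real_derivative q t - p t) (at t within {0..})" if "t \<ge> 0" for t
    unfolding D_def
    using DERIV_diff[OF logit[OF q] logit[OF p], OF that _ _ that] p01[OF that] q01[OF that]
    by simp
  have D_pos: "D t > 0" if "t \<ge> 0" for t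
    using p01[OF that] q01[OF that] less[OF that]
    by (simp add: D_def) (smt (verit) ln_less_cancel_iff)
  \<comment> \<open>The exponential of \<open>D\<close> is the odds ratio
    \<open>q (1 - p) / (p (1 - q))\<close>; subtracting \<open>1\<close> leaves
    \<open>(q - p) / (p (1 - q))\<close>.\<close>
  have D_exp: "q t - p t = (exp (D t) - 1) * (p t * (1 - q t))" if "t \<ge> 0" for t
    using p01[OF that] q01[OF that]
    by (simp add: D_def exp_diff exp_add field_simps)
  \<comment> \<open>With \<open>D\<close> the difference of the logits, \<open>D' = q - p = (exp D - 1) p (1 - q) \<ge> D\<^sup>2 H / 2\<close>,
    so the bounded function \<open>-1/D\<close> has derivative at least \<open>H / 2\<close>.\<close>
  show ?thesis
    unfolding H_def[symmetric]
  proof (rule barbalat)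
    fix t :: real assume t: "t \<ge> 0"
    show "((\<lambda>t. - inverse (D t)) has_real_derivative (q t - p t) / (D t)\<^sup>2) (at t within {0..})"
      using D_pos[OF t] by (auto intro!: derivative_eq_intros D t simp: field_simps power2_eq_square)
    show "- inverse (D t) \<le> 0"
      using D_pos[OF t] by simp
    show "H t \<ge> 0"
      using g_react_bounds[of "p t"] g_react_bounds[of "q t"] p01[OF t] q01[OF t] by (simp add: H_def)
    have "H t = (p t * (1 - q t)) * ((1 - p t) * q t)"
      by (simp add: H_def g_react_def)
    also have "\<dots> \<le> (p t * (1 - q t)) * 1"
      using p01[OF t] q01[OF t] by (intro mult_left_mono mult_le_one) auto
    finally have "(D t)\<^sup>2 / 2 * H t \<le> (D t)\<^sup>2 / 2 * (p t * (1 - q t))"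
      by (intro mult_left_mono) auto
    \<comment> \<open>As \<open>D > 0\<close>, the quadratic Taylor bound gives
      \<open>exp D - 1 \<ge> D + D^2 / 2\<close>, and the linear term is dropped.\<close>
    also have "\<dots> \<le> (exp (D t) - 1) * (p t * (1 - q t))"
      using exp_lower_Taylor_quadratic[of "D t"] D_pos[OF t] p01[OF t] q01[OF t]
      by (intro mult_right_mono) auto
    also have "\<dots> = q t - p t"
      using D_exp[OF t] by simp
    finally show "1 / 2 * H t \<le> (q t - p t) / (D t)\<^sup>2"
      using D_pos[OF t] by (simp add: field_simps)
  next
    fix s t :: real assume st: "0 \<le> t" "t \<le> s"
    define H' where "H' t = (1 - 2 * p t) * (f_react (p t) - l t * g_react (p t)) * g_react (q t)
      + g_react (p t) * ((1 - 2 * q t) * (f_react (q t) - l t * g_react (q t)))" for t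
    have H'_deriv: "(H has_real_derivative H' x) (at x within {0..})" if "x \<ge> 0" for x
      unfolding H_def H'_def g_react_def[of "p _"] g_react_def[of "q _"]
      by (auto intro!: derivative_eq_intros p q that simp: g_react_def algebra_simps)
    have H'_within: "(H has_derivative (*) (H' x)) (at x within {t..s})" if "t \<le> x" "x \<le> s" for x
    proof (rule has_derivative_subset)
      show "(H has_derivative (*) (H' x)) (at x within {0..})"
        using H'_deriv[of x] that st by (simp add: has_field_derivative_def)
    qed (use st in auto)
    have *: "\<exists>x\<in>{t<..<s}. H s - H t = H' x * (s - t)" if "t < s"
      using mvt_simple[OF that H'_within] by blast
    \<comment> \<open>Each of the two terms from the product rule is a product of factors of modulus
      at most \<open>1\<close>, the factor \<open>1 - 2 z\<close> being the derivative of
      \<open>g\<close>. This gives the Lipschitz constant \<open>2\<close>.\<close>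
    have "\<bar>H' x\<bar> \<le> 2" if "x \<ge> 0" for x
    proof -
      have *: "\<bar>(1 - 2 * z) * (f_react z - l x * g_react z)\<bar> \<le> 1" if "0 < z" "z < 1" for z
      proof -
        have "l x * g_react z \<le> 1" "0 \<le> l x * g_react z"
          using l01[OF \<open>x \<ge> 0\<close>] g_react_bounds[of z] that by (auto intro: mult_le_one)
        then have "\<bar>f_react z - l x * g_react z\<bar> \<le> 1"
          using g_react_bounds[of z] that by linarith
        then show ?thesis
          unfolding abs_mult using that by (intro mult_le_one) auto
      qed
      have "\<bar>(1 - 2 * p x) * (f_react (p x) - l x * g_react (p x)) * g_react (q x)\<bar> \<le> 1"
        unfolding abs_mult[of _ "g_react (q x)"]
        using *[of "p x"] p01[OF that] q01[OF that] g_react_bounds[of "q x"]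
        by (intro mult_le_one) auto
      moreover have "\<bar>g_react (p x) * ((1 - 2 * q x) * (f_react (q x) - l x * g_react (q x)))\<bar> \<le> 1"
        unfolding abs_mult[of "g_react (p x)"]
        using *[of "q x"] p01[OF that] q01[OF that] g_react_bounds[of "p x"]
        by (intro mult_le_one) auto
      ultimately show ?thesis
        unfolding H'_def by linarith
    qed
    then have "- 2 * (s - t) \<le> H' x * (s - t)" if "t < x" for x
      using st that by (intro mult_right_mono) (smt (verit))+
    with * show "H t - 2 * (s - t) \<le> H s"
      using st by (cases "t = s") (auto, smt (verit))
  qed auto
qed

section \<open>The nonlocal problem\<close>

text \<open>The double integral is treated as an iterated one, by two applications of dominated
  convergence: for fixed \<open>x\<close> the integral over \<open>y\<close> gives
  \<open>g_react (w t x) * I t\<close>, and integrating this over \<open>x\<close> gives the square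
  of \<open>I t\<close>.\<close>

lemma (in finite_measure) reaction_integral_tendsto:
  assumes meas [measurable]: "\<And>t. w t \<in> borel_measurable M"
    and l: "continuous_on {0..} l" and l01: "\<And>t. t \<ge> 0 \<Longrightarrow> 0 \<le> l t \<and> l t \<le> 1"
    and ode: "AE x in M. \<forall>t\<ge>0.
      ((\<lambda>t. w t x) has_real_derivative f_react (w t x) - l t * g_react (w t x)) (at t within {0..})"
    and init: "AE x in M. 0 \<le> w 0 x \<and> w 0 x \<le> 1"
    and levels: "\<And>s. 0 < s \<Longrightarrow> s < 1 \<Longrightarrow> AE x in M. w 0 x \<noteq> s"
  shows "((\<lambda>t. \<integral>x. g_react (w t x) \<partial>M) \<longlongrightarrow> 0) at_top"
proof -
  define good where "good x \<longleftrightarrow> (\<forall>t\<ge>0. ((\<lambda>t. w t x) has_real_derivative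
      f_react (w t x) - l t * g_react (w t x)) (at t within {0..})) \<and> 0 \<le> w 0 x \<and> w 0 x \<le> 1" for x
  have AE_good: "AE x in M. good x"
    using ode init unfolding good_def by eventually_elim blast
  have bounds: "0 \<le> g_react (w t x)" "g_react (w t x) \<le> 1" if "good x" "t \<ge> 0" for t x
  proof -
    obtain a b where "a > 0" "b > 0" "w t x = w 0 x * a" "1 - w t x = (1 - w 0 x) * b"
      using reaction_solution_factor[OF l, of "\<lambda>t. w t x" t] \<open>good x\<close> \<open>t \<ge> 0\<close>
      unfolding good_def by blast
    then have "0 \<le> w t x" "0 \<le> 1 - w t x"
      using \<open>good x\<close> unfolding good_def by (metis diff_ge_0_iff_ge mult_nonneg_nonneg less_imp_le)+
    then show "0 \<le> g_react (w t x)" "g_react (w t x) \<le> 1"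
      using g_react_bounds[of "w t x"] by auto
  qed
  have endpoint: "g_react (w t x) = 0" if "good x" "t \<ge> 0" "w 0 x = 0 \<or> w 0 x = 1" for t x
  proof -
    obtain a b where "a > 0" "b > 0" "w t x = w 0 x * a" "1 - w t x = (1 - w 0 x) * b"
      using reaction_solution_factor[OF l, of "\<lambda>t. w t x" t] \<open>good x\<close> \<open>t \<ge> 0\<close>
      unfolding good_def by blast
    then show ?thesis
      using that(3) by (auto simp: g_react_def)
  qed
  have pair: "((\<lambda>t. g_react (w t x) * g_react (w t y)) \<longlongrightarrow> 0) at_top"
    if "good x" "good y" "w 0 x \<noteq> w 0 y" for x y
  proof (cases "w 0 x \<in> {0, 1} \<or> w 0 y \<in> {0, 1}")
    case True
    then have "\<forall>\<^sub>F t in at_top. g_react (w t x) * g_react (w t y) = 0"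
      using endpoint that by (intro eventually_at_top_linorderI[of 0]) auto
    then show ?thesis by (simp add: tendsto_eventually)
  next
    case False
    with that have *: "0 < w 0 x" "w 0 x < 1" "0 < w 0 y" "w 0 y < 1"
      unfolding good_def by auto
    have "((\<lambda>t. g_react (w t y) * g_react (w t z)) \<longlongrightarrow> 0) at_top"
      if "good y" "good z" "0 < w 0 y" "w 0 y < w 0 z" "w 0 z < 1" for y z
      using that unfolding good_def by (intro reaction_pair_tendsto[OF l l01]) auto
    from this[of x y] this[of y x] that * show ?thesis
      by (cases "w 0 x" "w 0 y" rule: linorder_cases) (auto simp: mult.commute)
  qed
  have [measurable]: "(\<lambda>x. g_react (w t x)) \<in> borel_measurable M" for t
    unfolding g_react_def by measurable
  define I where "I t = (\<integral>x. g_react (w t x) \<partial>M)" for t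
  have I_bound: "\<bar>I t\<bar> \<le> measure M (space M)" if "t \<ge> 0" for t
  proof -
    have "AE x in M. \<bar>g_react (w t x)\<bar> \<le> 1"
      using AE_good by eventually_elim (use bounds that in auto)
    from abs_integral_le[OF this] show ?thesis by (simp add: I_def)
  qed
  have step: "((\<lambda>t. g_react (w t x) * I t) \<longlongrightarrow> 0) at_top" if "good x" for x
  \<comment> \<open>The level sets of \<open>0\<close> and \<open>1\<close> may have positive
    measure, but \<open>g_react\<close> vanishes along those trajectories. For all other
    \<open>x\<close>, \<open>levels\<close> says that almost every \<open>y\<close> starts at a
    different value.\<close>
  proof (cases "w 0 x \<in> {0, 1}")
    case True
    then have "\<forall>\<^sub>F t in at_top. g_react (w t x) * I t = 0"
      using endpoint that by (intro eventually_at_top_linorderI[of 0]) auto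
    then show ?thesis by (simp add: tendsto_eventually)
  next
    case False
    with that have "0 < w 0 x" "w 0 x < 1"
      unfolding good_def by auto
    then have "AE y in M. w 0 y \<noteq> w 0 x" by (rule levels)
    have "((\<lambda>t. \<integral>y. g_react (w t x) * g_react (w t y) \<partial>M) \<longlongrightarrow> (\<integral>y. 0 \<partial>M)) at_top"
    proof (rule integral_dominated_convergence_at_top)
      show "AE y in M. ((\<lambda>t. g_react (w t x) * g_react (w t y)) \<longlongrightarrow> 0) at_top"
        using AE_good \<open>AE y in M. w 0 y \<noteq> w 0 x\<close>
        by eventually_elim (use pair that in metis)
      show "\<forall>\<^sub>F t in at_top. AE y in M. norm (g_react (w t x) * g_react (w t y)) \<le> 1"
      proof (intro eventually_at_top_linorderI[of 0])
        fix t :: real assume "t \<ge> 0"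
        show "AE y in M. norm (g_react (w t x) * g_react (w t y)) \<le> 1"
          using AE_good by eventually_elim
            (use bounds[OF that \<open>t \<ge> 0\<close>] bounds[OF _ \<open>t \<ge> 0\<close>] in \<open>auto simp: abs_mult intro!: mult_le_one\<close>)
      qed
    qed auto
    then show ?thesis by (simp add: I_def)
  qed
  have "((\<lambda>t. \<integral>x. g_react (w t x) * I t \<partial>M) \<longlongrightarrow> (\<integral>x. 0 \<partial>M)) at_top"
  proof (rule integral_dominated_convergence_at_top)
    show "AE x in M. ((\<lambda>t. g_react (w t x) * I t) \<longlongrightarrow> 0) at_top"
      using AE_good by eventually_elim (rule step)
    show "\<forall>\<^sub>F t in at_top. AE x in M. norm (g_react (w t x) * I t) \<le> measure M (space M)"
    proof (intro eventually_at_top_linorderI[of 0])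
      fix t :: real assume t: "t \<ge> 0"
      show "AE x in M. norm (g_react (w t x) * I t) \<le> measure M (space M)"
        using AE_good
      proof eventually_elim
        case (elim x)
        have "\<bar>g_react (w t x)\<bar> * \<bar>I t\<bar> \<le> 1 * measure M (space M)"
          using bounds[OF elim t] I_bound[OF t] by (intro mult_mono) auto
        then show ?case by (simp add: abs_mult)
      qed
    qed
  qed auto
  then have "((\<lambda>t. I t * I t) \<longlongrightarrow> 0) at_top"
    by (simp add: I_def)
  \<comment> \<open>The square root of the square is \<open>\<bar>I t\<bar>\<close>, so the sign of
    \<open>I t\<close> need not be discussed.\<close>
  then have "((\<lambda>t. sqrt (I t * I t)) \<longlongrightarrow> sqrt 0) at_top"
    by (rule tendsto_real_sqrt)
  then show ?thesis
    by (simp add: I_def tendsto_rabs_zero_iff)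
qed

theorem proposition4p7:
  fixes \<Omega> :: "(real ^ 'n) set"
    and u0 :: "real ^ 'n \<Rightarrow> real"
    and u :: "real \<Rightarrow> real ^ 'n \<Rightarrow> real"
  assumes "open \<Omega>" and "bounded \<Omega>"
    and "u0 \<in> Linf \<Omega>"
    and "AE x in lebesgue_on \<Omega>. 0 \<le> u0 x \<and> u0 x \<le> 1"
    and "\<not> (AE x in lebesgue_on \<Omega>. u0 x * (1 - u0 x) = 0)"
    and "global_solution \<Omega> u0 u"
    and "\<And>s. 0 < s \<Longrightarrow> s < 1 \<Longrightarrow> emeasure lebesgue {x \<in> \<Omega>. u0 x = s} = 0"
  shows "((\<lambda>t. LINT x|lebesgue_on \<Omega>. g_react (u t x)) \<longlongrightarrow> 0) at_top \<and>
         ((\<lambda>t. LINT x|lebesgue_on \<Omega>. f_react (u t x)) \<longlongrightarrow> 0) at_top"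
proof -
  define M where "M = lebesgue_on \<Omega>"
  have \<Omega>: "\<Omega> \<in> lmeasurable"
    using assms(1,2) by (rule lmeasurable_open[rotated])
  have [simp]: "space M = \<Omega>" by (simp add: M_def)
  interpret finite_measure M
    unfolding M_def
  proof
    show "emeasure (lebesgue_on \<Omega>) (space (lebesgue_on \<Omega>)) \<noteq> \<infinity>"
      using \<Omega> by (simp add: emeasure_restrict_space fmeasurable_def less_top del: emeasure_completion)
  qed
  obtain u' where C1: "C1_Linf \<Omega> u u'" and u_0: "AE x in M. u 0 x = u0 x"
    and g_nz: "\<And>t. t \<ge> 0 \<Longrightarrow> (\<integral>x. g_react (u t x) \<partial>M) \<noteq> 0"
    and eqn: "\<And>t. t \<ge> 0 \<Longrightarrow>
      AE x in M. u' t x = f_react (u t x) - lam \<Omega> u t * g_react (u t x)"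
    using assms(6) unfolding global_solution_def M_def by blast
  note deriv = C1_Linf_imp(1)[OF C1, folded M_def] and cont' = C1_Linf_imp(2)[OF C1, folded M_def]
  have Linf: "u t \<in> Linf \<Omega>" "u' t \<in> Linf \<Omega>" if "t \<ge> 0" for t
    using C1 that by (auto simp: C1_Linf_def)
  have meas: "u t \<in> borel_measurable M" "u' t \<in> borel_measurable M" if "t \<ge> 0" for t
    using Linf[OF that] by (auto simp: Linf_def M_def)
  have bdd: "\<exists>C. AE x in M. \<bar>u t x\<bar> \<le> C" "\<exists>C. AE x in M. \<bar>u' t x\<bar> \<le> C" if "t \<ge> 0" for t
    using Linf[OF that] unfolding M_def by (auto intro: Linf_bounded)
  have int: "integrable M (u t)" "integrable M (u' t)" if "t \<ge> 0" for t
  proof -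
    have "integrable M h" if "h \<in> borel_measurable M" "\<exists>C. AE x in M. \<bar>h x\<bar> \<le> C" for h :: "_ \<Rightarrow> real"
      using that integrable_const_bound[of h] by (auto simp del: real_norm_def simp flip: real_norm_def)
    then show "integrable M (u t)" "integrable M (u' t)"
      using bdd[OF that] meas[OF that] by blast+
  qed
  have cont: "Linf_continuous M u"
    using deriv bdd(2) by (rule Linf_derivative_imp_continuous)
  obtain w where w: "\<And>t. w t \<in> borel_measurable M" "\<And>t. t \<ge> 0 \<Longrightarrow> AE x in M. w t x = u t x"
    "\<And>x. continuous_on {0..} (\<lambda>t. w t x)"
    using continuous_representative[OF cont meas(1)] by blast
  \<comment> \<open>Taken with \<open>f_react\<close> and \<open>g_react\<close> as
    \<open>h\<close>, this makes numerator and denominator of \<open>lam\<close> continuous in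
    time.\<close>
  have cont_int: "continuous_on {0..} (\<lambda>t. \<integral>x. h (u t x) \<partial>M)"
    if h: "continuous_on UNIV h" for h :: "real \<Rightarrow> real"
  proof (rule continuous_on_integral_Linf)
    show "Linf_continuous M (\<lambda>t x. h (u t x))"
      using cont bdd(1) h by (rule Linf_continuous_compose)
    fix t :: real assume t: "t \<ge> 0"
    obtain C where C: "AE x in M. \<bar>u t x\<bar> \<le> C"
      using bdd(1)[OF t] by blast
    have "compact (h ` {-C..C})"
      using h by (intro compact_continuous_image) (auto intro: continuous_on_subset)
    then have "\<exists>B. \<forall>z\<in>{-C..C}. \<bar>h z\<bar> \<le> B"
      using compact_imp_bounded[of "h ` {-C..C}"] by (simp add: bounded_iff)
    then obtain B where B: "\<And>z. z \<in> {-C..C} \<Longrightarrow> \<bar>h z\<bar> \<le> B"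
      by blast
    show "integrable M (\<lambda>x. h (u t x))"
    proof (rule integrable_const_bound)
      show "AE x in M. norm (h (u t x)) \<le> B"
        using C by eventually_elim (use B in \<open>simp add: abs_le_iff\<close>)
      show "(\<lambda>x. h (u t x)) \<in> borel_measurable M"
        using h meas(1)[OF t] by (rule borel_measurable_continuous_on)
    qed
  qed
  define l where "l = lam \<Omega> u"
  have l: "continuous_on {0..} l"
    unfolding l_def lam_def M_def[symmetric] using g_nz
    by (intro continuous_on_divide cont_int)
      (auto simp: f_react_def[abs_def] g_react_def[abs_def] intro!: continuous_intros)
  have ode: "AE x in M. \<forall>t\<ge>0.
      ((\<lambda>t. w t x) has_real_derivative f_react (w t x) - l t * g_react (w t x)) (at t within {0..})"
  \<comment> \<open>No separate representative of \<open>u'\<close> is constructed: the right-hand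
    side of the equation evaluated at \<open>w\<close> is continuous in time for every
    \<open>x\<close>, and equals \<open>u' t\<close> almost everywhere for each
    \<open>t\<close>.\<close>
  proof (rule representative_has_derivative[OF deriv cont' int w(2) _ w(3)])
    show "AE x in M. f_react (w t x) - l t * g_react (w t x) = u' t x" if "t \<ge> 0" for t
      using w(2)[OF that] eqn[OF that] by eventually_elim (simp add: l_def)
    show "continuous_on {0..} (\<lambda>t. f_react (w t x) - l t * g_react (w t x))" for x
      unfolding f_react_def g_react_def by (intro continuous_intros l w(3))
  qed
  have w_0: "AE x in M. w 0 x = u0 x"
    using w(2)[OF order_refl] u_0 by eventually_elim simp
  have init: "AE x in M. 0 \<le> w 0 x \<and> w 0 x \<le> 1"
    using w_0 assms(4)[folded M_def] by eventually_elim simp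
  \<comment> \<open>The invariance of the unit interval is derived from the equation itself, through
    the two factorizations.\<close>
  have w01: "AE x in M. 0 \<le> w t x \<and> w t x \<le> 1" if "t \<ge> 0" for t
    using ode init
  proof eventually_elim
    case (elim x)
    obtain a b where "a > 0" "b > 0" "w t x = w 0 x * a" "1 - w t x = (1 - w 0 x) * b"
      using reaction_solution_factor[OF l, of "\<lambda>t. w t x" t] elim \<open>t \<ge> 0\<close> by blast
    then show ?case
      using elim by (metis diff_ge_0_iff_ge mult_nonneg_nonneg less_imp_le)
  qed
  \<comment> \<open>For each single \<open>t\<close> the representative differs from
    \<open>u t\<close> only on a null set, so statements about integrals move freely between
    \<open>u\<close> and \<open>w\<close>.\<close>
  have int_eq: "(\<integral>x. h (u t x) \<partial>M) = (\<integral>x. h (w t x) \<partial>M)"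
    if "t \<ge> 0" "h \<in> borel_measurable borel" for t and h :: "real \<Rightarrow> real"
  proof (rule integral_cong_AE)
    show "AE x in M. h (u t x) = h (w t x)"
      using w(2)[OF that(1)] by eventually_elim simp
  qed (use that meas(1)[OF that(1)] w(1) in \<open>auto intro: measurable_compose\<close>)
  have [measurable]: "f_react \<in> borel_measurable borel" "g_react \<in> borel_measurable borel"
    unfolding f_react_def[abs_def] g_react_def[abs_def] by measurable
  have f_le_g: "0 \<le> (\<integral>x. f_react (u t x) \<partial>M)"
      "(\<integral>x. f_react (u t x) \<partial>M) \<le> (\<integral>x. g_react (u t x) \<partial>M)" if "t \<ge> 0" for t
  proof -
    have [measurable]: "w t \<in> borel_measurable M" by (rule w)
    have "integrable M (\<lambda>x. g_react (w t x))"
    proof (rule integrable_const_bound[of _ 1])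
      show "AE x in M. norm (g_react (w t x)) \<le> 1"
        using w01[OF that] by eventually_elim (use g_react_bounds in auto)
    qed measurable
    moreover have "AE x in M. 0 \<le> f_react (w t x)" "AE x in M. f_react (w t x) \<le> g_react (w t x)"
      "AE x in M. 0 \<le> g_react (w t x)"
      using w01[OF that] by (eventually_elim, use g_react_bounds in auto)+
    ultimately have "0 \<le> (\<integral>x. f_react (w t x) \<partial>M)"
      "(\<integral>x. f_react (w t x) \<partial>M) \<le> (\<integral>x. g_react (w t x) \<partial>M)"
      by (auto intro: integral_nonneg_AE integral_mono_AE')
    then show "0 \<le> (\<integral>x. f_react (u t x) \<partial>M)"
      "(\<integral>x. f_react (u t x) \<partial>M) \<le> (\<integral>x. g_react (u t x) \<partial>M)"
      using that by (simp_all add: int_eq)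
  qed
  \<comment> \<open>The integral of \<open>g_react\<close> is nonnegative and nonzero, hence
    positive, and it dominates that of \<open>f_react\<close>; so the quotient lies in the unit
    interval.\<close>
  have l01: "0 \<le> l t \<and> l t \<le> 1" if "t \<ge> 0" for t
    using f_le_g[OF that] g_nz[OF that] by (simp add: l_def lam_def M_def[symmetric] divide_le_eq)
  have levels: "AE x in M. w 0 x \<noteq> s" if "0 < s" "s < 1" for s
  proof -
    have [measurable]: "u0 \<in> borel_measurable M"
      using assms(3) by (simp add: Linf_def M_def)
    have "{x \<in> space M. u0 x = s} \<in> sets M" by measurable
    moreover have "emeasure M {x \<in> \<Omega>. u0 x = s} = 0"
      unfolding M_def using assms(7)[OF that] \<Omega>
      by (subst emeasure_restrict_space) (auto simp: fmeasurable_def)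
    ultimately have "AE x in M. u0 x \<noteq> s"
      by (subst AE_iff_measurable[OF _ refl]) auto
    with w_0 show ?thesis by eventually_elim simp
  qed
  have "((\<lambda>t. \<integral>x. g_react (w t x) \<partial>M) \<longlongrightarrow> 0) at_top"
    using w(1) l l01 ode init levels by (rule reaction_integral_tendsto)
  then have g: "((\<lambda>t. \<integral>x. g_react (u t x) \<partial>M) \<longlongrightarrow> 0) at_top"
    by (rule Lim_transform_eventually)
      (auto simp: int_eq eventually_at_top_linorder intro!: exI[of _ 0])
  moreover have "((\<lambda>t. \<integral>x. f_react (u t x) \<partial>M) \<longlongrightarrow> 0) at_top"
    using f_le_g by (intro tendsto_sandwich[OF _ _ tendsto_const g])
      (auto simp: eventually_at_top_linorder intro!: exI[of _ 0])
  ultimately show ?thesis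
    by (simp add: M_def)
qed

end
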